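(* For all integers $n \ge m \ge 2$, the outcome of the Maker-Breaker domination game on the grid $P_m \square P_n$ is $\mathcal{D}$, i.e., Dominator has a winning strategy both in the D-game and in the S-game on $P_m \square P_n$.
   Context: The Maker-Breaker domination game on a finite graph $G$ is played by two players, Dominator and Staller, who alternately select (claim) a previously unplayed vertex of $G$ until all vertices are played. Dominator wins if the set of vertices he claimed is a dominating set of $G$ (every vertex is in it or adjacent to a vertex in it); otherwise Staller wins, equivalently Staller wins iff she claims all vertices of some closed neighborhood $N_G[v]=\{v\}\cup N_G(v)$. The game is a D-game if Dominator makes the first move and an S-game if Staller makes the first move. The outcome $o(G)$ is $\mathcal{D}$ if Dominator has a winning strategy in both the D-game and the S-game, $\mathcal{S}$ if Staller has a winning strategy in both games, and $\mathcal{N}$ if the first player has a winning strategy in each game. $P_k$ denotes the path on $k$ vertices and $G \square H$ the Cartesian product of graphs $G$ and $H$ (vertex set $V(G)\times V(H)$, with $(g,h)\sim(g',h')$ iff either $gg'\in E(G)$ and $h=h'$, or $g=g'$ and $hh'\in E(H)$). *)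

theory Defs
  imports "Graph_Theory.Pair_Digraph"
begin

text \<open>
  Finite simple graphs are the graphs of locale \<^locale>\<open>pair_graph\<close>: finite, loopless, and with
  a symmetric arc relation, each undirected edge being represented by its two orientations.
\<close>

definition path_graph :: "nat \<Rightarrow> nat pair_pre_digraph" where
  "path_graph k =
    \<lparr> pverts = {..<k}, parcs = {(i, j). i < k \<and> j < k \<and> (j = Suc i \<or> i = Suc j)} \<rparr>"

definition cartesian_product ::
  "'a pair_pre_digraph \<Rightarrow> 'b pair_pre_digraph \<Rightarrow> ('a \<times> 'b) pair_pre_digraph"  (infixr "\<box>" 70) where
  "G \<box> H =
    \<lparr> pverts = pverts G \<times> pverts H,
      parcs = {((g, h), (g', h')).
        (g, g') \<in> parcs G \<and> h \<in> pverts H \<and> h = h' \<or>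
        g \<in> pverts G \<and> g = g' \<and> (h, h') \<in> parcs H} \<rparr>"

lemma pair_graph_path_graph: "pair_graph (path_graph k)"
proof
  have "parcs (path_graph k) \<subseteq> {..<k} \<times> {..<k}"
    by (auto simp: path_graph_def)
  then show "finite (parcs (path_graph k))"
    by (rule finite_subset) simp
qed (auto simp: path_graph_def symmetric_def sym_def)

lemma pair_graph_cartesian_product:
  assumes "pair_graph G" "pair_graph H"
  shows "pair_graph (G \<box> H)"
proof -
  interpret G: pair_graph G by fact
  interpret H: pair_graph H by fact
  have symG: "(u, v) \<in> parcs G \<Longrightarrow> (v, u) \<in> parcs G" for u v
    using G.arcs_symmetric by auto
  have symH: "(u, v) \<in> parcs H \<Longrightarrow> (v, u) \<in> parcs H" for u v
    using H.arcs_symmetric by auto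
  show ?thesis
  proof
    have "parcs (G \<box> H) \<subseteq> (pverts G \<times> pverts H) \<times> (pverts G \<times> pverts H)"
      by (auto simp: cartesian_product_def dest: G.in_arcsD1 G.in_arcsD2 H.in_arcsD1 H.in_arcsD2)
    then show "finite (parcs (G \<box> H))"
      by (rule finite_subset) simp
  qed (auto simp: cartesian_product_def symmetric_def sym_def intro: symG symH
        dest: G.in_arcsD1 G.in_arcsD2 H.in_arcsD1 H.in_arcsD2 G.no_loops' H.no_loops')
qed

definition dominating_set :: "'a pair_pre_digraph \<Rightarrow> 'a set \<Rightarrow> bool" where
  "dominating_set G D \<longleftrightarrow>
    D \<subseteq> pverts G \<and> (\<forall>v \<in> pverts G. v \<in> D \<or> (\<exists>u \<in> D. (u, v) \<in> parcs G))"

datatype player = Dominator | Staller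

fun opponent :: "player \<Rightarrow> player" where
  "opponent Dominator = Staller"
| "opponent Staller = Dominator"

text \<open>
  A game position is the list of the vertices played so far, in chronological order. The parameter
  \<open>first\<close> is the player who makes the first move: \<^const>\<open>Dominator\<close> in the D-game,
  \<^const>\<open>Staller\<close> in the S-game.
\<close>

definition position :: "'a pair_pre_digraph \<Rightarrow> 'a list \<Rightarrow> bool" where
  "position G xs \<longleftrightarrow> distinct xs \<and> set xs \<subseteq> pverts G"

definition complete_play :: "'a pair_pre_digraph \<Rightarrow> 'a list \<Rightarrow> bool" where
  "complete_play G xs \<longleftrightarrow> position G xs \<and> set xs = pverts G"

text \<open>The player making the move with index \<open>i\<close>, counted from 0.\<close>

definition mover :: "player \<Rightarrow> nat \<Rightarrow> player" where
  "mover first i = (if even i then first else opponent first)"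

definition claimed :: "player \<Rightarrow> 'a list \<Rightarrow> player \<Rightarrow> 'a set" where
  "claimed first xs p = {xs ! i | i. i < length xs \<and> mover first i = p}"

fun wins :: "'a pair_pre_digraph \<Rightarrow> player \<Rightarrow> 'a list \<Rightarrow> player \<Rightarrow> bool" where
  "wins G first xs Dominator \<longleftrightarrow> dominating_set G (claimed first xs Dominator)"
| "wins G first xs Staller \<longleftrightarrow> \<not> dominating_set G (claimed first xs Dominator)"

text \<open>
  A strategy of player \<open>p\<close> assigns an unplayed vertex to every non-final position in which
  \<open>p\<close> is to move; its values on all other lists are irrelevant.
\<close>

definition strategy ::
  "'a pair_pre_digraph \<Rightarrow> player \<Rightarrow> player \<Rightarrow> ('a list \<Rightarrow> 'a) \<Rightarrow> bool" where
  "strategy G first p \<sigma> \<longleftrightarrow>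
    (\<forall>xs. position G xs \<and> \<not> complete_play G xs \<and> mover first (length xs) = p \<longrightarrow>
      \<sigma> xs \<in> pverts G - set xs)"

definition follows :: "player \<Rightarrow> player \<Rightarrow> ('a list \<Rightarrow> 'a) \<Rightarrow> 'a list \<Rightarrow> bool" where
  "follows first p \<sigma> xs \<longleftrightarrow>
    (\<forall>i < length xs. mover first i = p \<longrightarrow> xs ! i = \<sigma> (take i xs))"

definition has_winning_strategy :: "'a pair_pre_digraph \<Rightarrow> player \<Rightarrow> player \<Rightarrow> bool" where
  "has_winning_strategy G first p \<longleftrightarrow>
    (\<exists>\<sigma>. strategy G first p \<sigma> \<and>
      (\<forall>xs. complete_play G xs \<and> follows first p \<sigma> xs \<longrightarrow> wins G first xs p))"

datatype outcome = Outcome_D | Outcome_S | Outcome_N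

text \<open>
  The outcome is given as a relation, since its being a total function is a theorem about
  the game (determinacy, and the fact that moving first is never a disadvantage).
\<close>

fun has_outcome :: "'a pair_pre_digraph \<Rightarrow> outcome \<Rightarrow> bool" where
  "has_outcome G Outcome_D \<longleftrightarrow> (\<forall>first. has_winning_strategy G first Dominator)"
| "has_outcome G Outcome_S \<longleftrightarrow> (\<forall>first. has_winning_strategy G first Staller)"
| "has_outcome G Outcome_N \<longleftrightarrow> (\<forall>first. has_winning_strategy G first first)"

end

theory Submission
  imports Defs "HOL-Combinatorics.Transposition"
begin

text \<open>
  If \<open>m\<close> or \<open>n\<close> is even, the grid has a perfect matching, and Dominator answers every move of
  Staller at the other end of its edge; every closed neighbourhood contains the edge of its centre,
  so Staller never fills one. If both are odd, no pairing can work from the start: a pair lies in at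
  most two closed neighbourhoods, so all pairs together cover at most \<open>mn - 1\<close> of the \<open>mn\<close>
  neighbourhoods. But the complement of a \<open>3 \<times> 3\<close> corner block has a perfect matching, and inside
  the block each first move of Staller has an answer after which the remaining vertices admit a
  pairing with a pair inside every closed neighbourhood not yet hit. In the game with Dominator moving first, he
  plays such an answer to an imagined move of Staller.
\<close>

section \<open>Plays, claimed sets and strategies obtained from invariants\<close>

lemma claimed_Nil [simp]: "claimed first [] p = {}"
  by (simp add: claimed_def)

lemma claimed_snoc:
  "claimed first (xs @ [x]) p =
    (if mover first (length xs) = p then insert x (claimed first xs p) else claimed first xs p)"
proof -
  have mem: "y \<in> claimed first ys p \<longleftrightarrow> (\<exists>i < length ys. mover first i = p \<and> ys ! i = y)" for y ys
    unfolding claimed_def by blast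
  have "y \<in> claimed first (xs @ [x]) p \<longleftrightarrow>
      y \<in> claimed first xs p \<or> mover first (length xs) = p \<and> y = x" for y
    unfolding mem length_append_singleton Ex_less_Suc
    by (simp add: nth_append cong: conj_cong) (metis (full_types))
  then show ?thesis by (intro set_eqI) (simp add: disj_commute)
qed

lemma claimed_Un: "claimed first xs Staller \<union> claimed first xs Dominator = set xs"
proof -
  have "mover first i = Staller \<or> mover first i = Dominator" for i
    by (cases "mover first i") auto
  then show ?thesis
    unfolding claimed_def set_conv_nth by blast
qed

lemma claimed_disjoint:
  assumes "distinct xs"
  shows "claimed first xs Staller \<inter> claimed first xs Dominator = {}"
  using assms by (auto simp: claimed_def nth_eq_iff_index_eq)

lemma follows_snoc:
  "follows first p \<sigma> (xs @ [x]) \<longleftrightarrow>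
    follows first p \<sigma> xs \<and> (mover first (length xs) = p \<longrightarrow> x = \<sigma> xs)"
  by (auto simp: follows_def nth_append less_Suc_eq)

text \<open>The strategy always picks a move that keeps \<open>Q\<close> if there is one; induction
  along the play then carries \<open>Q\<close> from the empty position to the final one.\<close>

lemma has_winning_strategyI:
  assumes init: "Q []"
    and other: "\<And>xs x. Q xs \<Longrightarrow> position G (xs @ [x]) \<Longrightarrow> mover first (length xs) \<noteq> p \<Longrightarrow> Q (xs @ [x])"
    and own: "\<And>xs. Q xs \<Longrightarrow> position G xs \<Longrightarrow> \<not> complete_play G xs \<Longrightarrow> mover first (length xs) = p
      \<Longrightarrow> \<exists>x \<in> pverts G - set xs. Q (xs @ [x])"
    and final: "\<And>xs. Q xs \<Longrightarrow> complete_play G xs \<Longrightarrow> wins G first xs p"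
  shows "has_winning_strategy G first p"
proof -
  \<comment> \<open>The second branch secures legality alone: \<open>strategy\<close> also asks for
    a free vertex at positions where no move keeps \<open>Q\<close>.\<close>
  define \<sigma> where "\<sigma> xs = (if \<exists>x \<in> pverts G - set xs. Q (xs @ [x])
    then SOME x. x \<in> pverts G - set xs \<and> Q (xs @ [x]) else SOME x. x \<in> pverts G - set xs)" for xs
  have good: "\<sigma> xs \<in> pverts G - set xs \<and> Q (xs @ [\<sigma> xs])"
    if "\<exists>x \<in> pverts G - set xs. Q (xs @ [x])" for xs
  proof -
    have "\<exists>x. x \<in> pverts G - set xs \<and> Q (xs @ [x])" using that by blast
    from someI_ex[OF this] show ?thesis using that by (simp add: \<sigma>_def)
  qed
  have "strategy G first p \<sigma>"
    unfolding strategy_def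
  proof (intro allI impI)
    fix xs assume "position G xs \<and> \<not> complete_play G xs \<and> mover first (length xs) = p"
    then have ex: "\<exists>x. x \<in> pverts G - set xs"
      by (auto simp: position_def complete_play_def)
    show "\<sigma> xs \<in> pverts G - set xs"
    proof (cases "\<exists>x \<in> pverts G - set xs. Q (xs @ [x])")
      case True
      then show ?thesis using good by blast
    next
      case False
      then show ?thesis using someI_ex[OF ex] by (simp add: \<sigma>_def)
    qed
  qed
  moreover have "Q xs" if "position G xs" "follows first p \<sigma> xs" for xs
    using that
  proof (induction xs rule: rev_induct)
    case Nil
    show ?case by (rule init)
  next
    case (snoc x xs)
    from snoc.prems have pos: "position G xs" and incomplete: "\<not> complete_play G xs"
      by (auto simp: position_def complete_play_def)
    from snoc pos have Q: "Q xs" by (simp add: follows_snoc)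
    show ?case
    proof (cases "mover first (length xs) = p")
      case True
      with snoc.prems have "x = \<sigma> xs" by (simp add: follows_snoc)
      with good own[OF Q pos incomplete True] show ?thesis by blast
    next
      case False
      with other Q snoc.prems show ?thesis by blast
    qed
  qed
  ultimately show ?thesis
    using final unfolding has_winning_strategy_def complete_play_def by blast
qed

section \<open>Closed neighbourhoods and invariants for Dominator\<close>

definition closed_nbhd :: "'a pair_pre_digraph \<Rightarrow> 'a \<Rightarrow> 'a set" where
  "closed_nbhd G v = {u \<in> pverts G. u = v \<or> (u, v) \<in> parcs G}"

lemma dominating_set_closed_nbhd:
  "dominating_set G D \<longleftrightarrow> D \<subseteq> pverts G \<and> (\<forall>v \<in> pverts G. closed_nbhd G v \<inter> D \<noteq> {})"
  by (fastforce simp: dominating_set_def closed_nbhd_def)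

text \<open>
  Below, \<open>S\<close> and \<open>D\<close> are the sets claimed by Staller and Dominator;
  \<open>A\<close> describes positions with Staller to move.
\<close>

definition dominator_can_restore ::
  "'a pair_pre_digraph \<Rightarrow> ('a set \<Rightarrow> 'a set \<Rightarrow> bool) \<Rightarrow> 'a set \<Rightarrow> 'a set \<Rightarrow> bool" where
  "dominator_can_restore G A S D \<longleftrightarrow>
    (if S \<union> D = pverts G then dominating_set G D else \<exists>d \<in> pverts G - S - D. A S (insert d D))"

text \<open>One invariant on the two claimed sets serves both games: the two parts of
  \<open>init\<close> are the starts of the S-game and of the D-game. If the board is full at
  Dominator's turn, no reply exists, and \<open>dominator_can_restore\<close> asks for domination
  itself.\<close>

lemma dominator_wins_by_invariant:
  assumes init: "A {} {}" "dominator_can_restore G A {} {}"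
    and step: "\<And>S D s. A S D \<Longrightarrow> S \<inter> D = {} \<Longrightarrow> S \<union> D \<subseteq> pverts G \<Longrightarrow> s \<in> pverts G - S - D
      \<Longrightarrow> dominator_can_restore G A (insert s S) D"
    and final: "\<And>S D. A S D \<Longrightarrow> S \<inter> D = {} \<Longrightarrow> S \<union> D = pverts G \<Longrightarrow> dominating_set G D"
  shows "has_outcome G Outcome_D"
proof -
  have "has_winning_strategy G first Dominator" for first
  proof (rule has_winning_strategyI)
    define Q where "Q xs = (let S = claimed first xs Staller; D = claimed first xs Dominator in
      if mover first (length xs) = Staller then A S D else dominator_can_restore G A S D)" for xs
    have opp: "mover first (Suc k) = Staller \<longleftrightarrow> mover first k = Dominator"
      "mover first k \<noteq> Staller \<longleftrightarrow> mover first k = Dominator" for k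
      by (cases first; simp add: mover_def)+
    show "Q []"
      using init by (simp add: Q_def)
    show "Q (xs @ [x])"
      if "Q xs" "position G (xs @ [x])" "mover first (length xs) \<noteq> Dominator" for xs x
    proof -
      from that(3) have St: "mover first (length xs) = Staller" using opp by blast
      have "dominator_can_restore G A (insert x (claimed first xs Staller)) (claimed first xs Dominator)"
      proof (rule step)
        show "A (claimed first xs Staller) (claimed first xs Dominator)"
          using that(1) St by (simp add: Q_def)
        show "claimed first xs Staller \<inter> claimed first xs Dominator = {}"
          using that(2) by (intro claimed_disjoint) (simp add: position_def)
        show "claimed first xs Staller \<union> claimed first xs Dominator \<subseteq> pverts G"
          using that(2) by (simp add: claimed_Un position_def)
        show "x \<in> pverts G - claimed first xs Staller - claimed first xs Dominator"
          using that(2) claimed_Un[of first xs] by (auto simp: position_def)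
      qed
      then show ?thesis using St by (simp add: Q_def claimed_snoc opp(1))
    qed
    show "\<exists>x \<in> pverts G - set xs. Q (xs @ [x])"
      if "Q xs" "position G xs" "\<not> complete_play G xs" "mover first (length xs) = Dominator" for xs
    proof -
      have "dominator_can_restore G A (claimed first xs Staller) (claimed first xs Dominator)"
        using that(1,4) by (simp add: Q_def)
      moreover have "claimed first xs Staller \<union> claimed first xs Dominator \<noteq> pverts G"
        using that(2,3) by (simp add: claimed_Un complete_play_def)
      ultimately obtain d where "d \<in> pverts G - claimed first xs Staller - claimed first xs Dominator"
        "A (claimed first xs Staller) (insert d (claimed first xs Dominator))"
        unfolding dominator_can_restore_def by auto
      then have "d \<in> pverts G - set xs" "Q (xs @ [d])"
        using claimed_Un[of first xs] that(4) by (auto simp: Q_def claimed_snoc opp(1))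
      then show ?thesis by blast
    qed
    show "wins G first xs Dominator" if "Q xs" "complete_play G xs" for xs
    proof -
      have "claimed first xs Staller \<inter> claimed first xs Dominator = {}"
        "claimed first xs Staller \<union> claimed first xs Dominator = pverts G"
        using that(2) by (auto simp: complete_play_def position_def claimed_Un claimed_disjoint)
      then show ?thesis
        using that(1) final by (auto simp: Q_def dominator_can_restore_def Let_def split: if_splits)
    qed
  qed
  then show ?thesis by simp
qed

section \<open>Pairing strategies\<close>

text \<open>Fixed points of \<open>f\<close> are the vertices left unpaired.\<close>

definition pairing :: "'a pair_pre_digraph \<Rightarrow> ('a \<Rightarrow> 'a) \<Rightarrow> 'a set \<Rightarrow> 'a set \<Rightarrow> bool" where
  "pairing G f S D \<longleftrightarrow> (\<forall>x \<in> pverts G. f (f x) = x) \<and>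
    (\<forall>v \<in> pverts G. closed_nbhd G v \<inter> D \<noteq> {} \<or>
      (\<exists>x \<in> closed_nbhd G v - S. f x \<in> closed_nbhd G v - S \<and> f x \<noteq> x))"

lemma closed_nbhd_subset: "closed_nbhd G v \<subseteq> pverts G"
  by (auto simp: closed_nbhd_def)

text \<open>Extra vertices for Dominator and the withdrawal of Staller's moves do no harm: hit
  neighbourhoods stay hit and intact pairs stay intact. This justifies both arbitrary spare moves
  and an imagined opening move of Staller.\<close>

lemma pairing_mono:
  assumes "pairing G f S D" "S' \<subseteq> S" "D \<subseteq> D'"
  shows "pairing G f S' D'"
  unfolding pairing_def
proof (intro conjI ballI)
  show "f (f x) = x" if "x \<in> pverts G" for x
    using assms(1) that by (simp add: pairing_def)
next
  fix v assume "v \<in> pverts G"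
  then consider "closed_nbhd G v \<inter> D \<noteq> {}"
    | x where "x \<in> closed_nbhd G v - S" "f x \<in> closed_nbhd G v - S" "f x \<noteq> x"
    using assms(1) unfolding pairing_def by blast
  then show "closed_nbhd G v \<inter> D' \<noteq> {} \<or>
    (\<exists>x \<in> closed_nbhd G v - S'. f x \<in> closed_nbhd G v - S' \<and> f x \<noteq> x)"
    using assms(2,3) by cases blast+
qed

text \<open>On a full board, a pair avoiding \<open>S\<close> lies in \<open>D\<close>, so its
  neighbourhood is hit as well.\<close>

lemma pairing_final:
  assumes "pairing G f S D" "S \<union> D = pverts G"
  shows "dominating_set G D"
  using assms closed_nbhd_subset[of G] unfolding pairing_def dominating_set_closed_nbhd by blast

text \<open>Only the pair through \<open>s\<close> is destroyed, and its other end
  \<open>f s\<close> hits every neighbourhood that contained this pair.\<close>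

lemma pairing_step:
  assumes f: "pairing G f S D" and s: "s \<in> pverts G"
  shows "pairing G f (insert s S) (insert (f s) D)"
  unfolding pairing_def
proof (intro conjI ballI)
  show "f (f x) = x" if "x \<in> pverts G" for x
    using f that by (simp add: pairing_def)
next
  fix v assume v: "v \<in> pverts G"
  then consider "closed_nbhd G v \<inter> D \<noteq> {}"
    | x where "x \<in> closed_nbhd G v - S" "f x \<in> closed_nbhd G v - S" "f x \<noteq> x" "f (f x) = x"
    using f closed_nbhd_subset[of G v] unfolding pairing_def by blast
  then show "closed_nbhd G v \<inter> insert (f s) D \<noteq> {} \<or>
    (\<exists>x \<in> closed_nbhd G v - insert s S. f x \<in> closed_nbhd G v - insert s S \<and> f x \<noteq> x)"
    by cases (blast, metis Diff_iff disjoint_iff insert_iff)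
qed

text \<open>If \<open>f s\<close> is free, it is the reply. Otherwise every neighbourhood relying on
  the pair of \<open>s\<close> has \<open>f s\<close> in \<open>D\<close> and is already hit; the
  pairing survives without a reply, and any free vertex will do. The predicate \<open>A\<close>
  allows pairings to be just one phase of a larger invariant.\<close>

lemma pairing_restore:
  assumes f: "pairing G f S D" and s: "s \<in> pverts G" "s \<notin> D" and sub: "S \<union> D \<subseteq> pverts G"
    and A: "\<And>S D. pairing G f S D \<Longrightarrow> A S D"
  shows "dominator_can_restore G A (insert s S) D"
proof (cases "f s \<in> pverts G - insert s S - D")
  case True
  then have "insert s S \<union> D \<noteq> pverts G" by blast
  with True A[OF pairing_step[OF f s(1)]] show ?thesis
    unfolding dominator_can_restore_def by auto
next
  case False
  have "pairing G f (insert s S) D"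
    unfolding pairing_def
  proof (intro conjI ballI)
    show "f (f x) = x" if "x \<in> pverts G" for x
      using f that by (simp add: pairing_def)
  next
    fix v assume v: "v \<in> pverts G"
    then consider "closed_nbhd G v \<inter> D \<noteq> {}"
      | x where "x \<in> closed_nbhd G v - S" "f x \<in> closed_nbhd G v - S" "f x \<noteq> x" "f (f x) = x"
      using f closed_nbhd_subset[of G v] unfolding pairing_def by blast
    then show "closed_nbhd G v \<inter> D \<noteq> {} \<or>
      (\<exists>x \<in> closed_nbhd G v - insert s S. f x \<in> closed_nbhd G v - insert s S \<and> f x \<noteq> x)"
    proof cases
      case 2
      with False closed_nbhd_subset[of G v] show ?thesis by (smt (verit) Diff_iff disjoint_iff insert_iff subsetD)
    qed blast
  qed
  then have p: "pairing G f (insert s S) D'" if "D \<subseteq> D'" for D'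
    using pairing_mono that by blast
  show ?thesis
  proof (cases "insert s S \<union> D = pverts G")
    case True
    with pairing_final[OF p[OF order_refl]] show ?thesis
      by (simp add: dominator_can_restore_def)
  next
    case False
    with s sub obtain d where "d \<in> pverts G - insert s S - D" by blast
    with False A[OF p[of "insert d D"]] show ?thesis
      unfolding dominator_can_restore_def by auto
  qed
qed

section \<open>A perfect matching outside a block\<close>

text \<open>
  Dominator answers along the perfect matching \<open>f\<close> outside \<open>B\<close> until Staller enters \<open>B\<close> for the
  first time; from then on he follows the pairing of \<open>B\<close> belonging to that move.
\<close>

lemma outcome_D_matching_block:
  assumes matching: "\<And>x. x \<in> pverts G - B \<Longrightarrow>
      f x \<in> pverts G - B \<and> f (f x) = x \<and> f x \<noteq> x \<and> (f x, x) \<in> parcs G"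
    and B: "B \<subseteq> pverts G"
    and block: "\<And>s. s \<in> B \<Longrightarrow> \<exists>d h. d \<in> B \<and> d \<noteq> s \<and> (\<forall>x \<in> B. h x \<in> B \<and> h (h x) = x) \<and>
      (\<forall>v \<in> B. d \<in> closed_nbhd G v \<or>
        (\<exists>x \<in> B \<inter> closed_nbhd G v - {s}. h x \<in> closed_nbhd G v - {s} \<and> h x \<noteq> x))"
  shows "has_outcome G Outcome_D"
proof -
  \<comment> \<open>The second alternative is the phase before Staller enters \<open>B\<close>:
    Dominator owns exactly the partners of her vertices.\<close>
  define A where "A S D \<longleftrightarrow> (\<exists>g. pairing G g S D) \<or> S \<subseteq> pverts G - B \<and> D = f ` S" for S D
  have enter: "\<exists>d g. d \<in> B \<and> d \<noteq> s \<and> pairing G g (insert s S) (insert d (f ` S))"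
    if s: "s \<in> B" and S: "S \<subseteq> pverts G - B" "S \<inter> f ` S = {}" for s S
  proof -
    from block[OF s] obtain d h where d: "d \<in> B" "d \<noteq> s"
      and h: "\<And>x. x \<in> B \<Longrightarrow> h x \<in> B" "\<And>x. x \<in> B \<Longrightarrow> h (h x) = x"
      and dom: "\<And>v. v \<in> B \<Longrightarrow> d \<in> closed_nbhd G v \<or>
        (\<exists>x \<in> B \<inter> closed_nbhd G v - {s}. h x \<in> closed_nbhd G v - {s} \<and> h x \<noteq> x)"
      by (metis (no_types, lifting))
    \<comment> \<open>\<open>h\<close> preserves \<open>B\<close> and \<open>f\<close> preserves its
      complement, so the glued map is again an involution.\<close>
    let ?g = "\<lambda>x. if x \<in> B then h x else f x"
    have "pairing G ?g (insert s S) (insert d (f ` S))"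
      unfolding pairing_def
    proof (intro conjI ballI)
      show "?g (?g x) = x" if "x \<in> pverts G" for x
        using that h matching[of x] by auto
    next
      fix v assume v: "v \<in> pverts G"
      show "closed_nbhd G v \<inter> insert d (f ` S) \<noteq> {} \<or>
        (\<exists>x \<in> closed_nbhd G v - insert s S. ?g x \<in> closed_nbhd G v - insert s S \<and> ?g x \<noteq> x)"
      proof (cases "v \<in> B")
        case True
        from dom[OF this] show ?thesis
        proof
          assume "\<exists>x \<in> B \<inter> closed_nbhd G v - {s}. h x \<in> closed_nbhd G v - {s} \<and> h x \<noteq> x"
          then obtain x where "x \<in> B" "x \<in> closed_nbhd G v" "x \<noteq> s"
            "h x \<in> closed_nbhd G v" "h x \<noteq> s" "h x \<noteq> x" by blast
          moreover from this S h have "x \<notin> S" "h x \<notin> S" by blast+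
          ultimately show ?thesis by (intro disjI2 bexI[of _ x]) auto
        qed blast
      next
        case False
        with v have m: "f v \<in> pverts G - B" "f (f v) = v" "f v \<noteq> v" "(f v, v) \<in> parcs G"
          using matching[of v] by auto
        with v have nb: "v \<in> closed_nbhd G v" "f v \<in> closed_nbhd G v"
          by (auto simp: closed_nbhd_def)
        \<comment> \<open>For a centre outside \<open>B\<close>, its own matching edge suffices: if
          Staller holds one end, Dominator holds the other; if she holds neither, the edge is an
          intact pair, as \<open>s\<close> is in \<open>B\<close>.\<close>
        consider "v \<in> S" | "f v \<in> S" | "v \<notin> S" "f v \<notin> S" by blast
        then show ?thesis
        proof cases
          case 1
          with nb show ?thesis by blast
        next
          case 2
          then have "v \<in> f ` S" using m(2) by (metis imageI)
          with nb show ?thesis by blast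
        next
          case 3
          with m nb False s show ?thesis by (intro disjI2 bexI[of _ v]) auto
        qed
      qed
    qed
    with d show ?thesis by blast
  qed
  show ?thesis
  proof (rule dominator_wins_by_invariant[of A])
    show "A {} {}" by (simp add: A_def)
    show "dominator_can_restore G A {} {}"
    proof (cases "B = {}")
      case True
      \<comment> \<open>Without a block, \<open>f\<close> itself is a pairing from the start, so any
        opening move is good.\<close>
      have "pairing G f {} D" for D
        unfolding pairing_def
      proof (intro conjI ballI disjI2)
        show "f (f x) = x" if "x \<in> pverts G" for x using matching[of x] that True by blast
        show "\<exists>x \<in> closed_nbhd G v - {}. f x \<in> closed_nbhd G v - {} \<and> f x \<noteq> x"
          if "v \<in> pverts G" for v
          using matching[of v] that True by (intro bexI[of _ v]) (auto simp: closed_nbhd_def)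
      qed
      then have "A {} D" for D by (auto simp: A_def)
      then show ?thesis
        by (auto simp: dominator_can_restore_def dominating_set_def)
    next
      case False
      then obtain s where "s \<in> B" by blast
      \<comment> \<open>Dominator opens with the answer \<open>d\<close> to an imagined move
        \<open>s\<close>, which \<open>pairing_mono\<close> then withdraws.\<close>
      from enter[OF this, of "{}"] obtain d g where "d \<in> B" "pairing G g {s} {d}" by auto
      moreover from this have "A {} {d}"
        using pairing_mono[of G g "{s}" "{d}" "{}" "{d}"] by (auto simp: A_def)
      ultimately show ?thesis using B by (auto simp: dominator_can_restore_def)
    qed
  next
    fix S D s
    assume A: "A S D" and SD: "S \<inter> D = {}" "S \<union> D \<subseteq> pverts G" and s: "s \<in> pverts G - S - D"
    show "dominator_can_restore G A (insert s S) D"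
    proof (cases "\<exists>g. pairing G g S D")
      case True
      then obtain g where g: "pairing G g S D" by blast
      show ?thesis
        by (rule pairing_restore[OF g]) (use s SD in \<open>auto simp: A_def\<close>)
    next
      case False
      with A have S: "S \<subseteq> pverts G - B" and D: "D = f ` S" by (auto simp: A_def)
      have "\<exists>d \<in> pverts G - insert s S - D. A (insert s S) (insert d D)"
      proof (cases "s \<in> B")
        case True
        with enter[OF this S] SD D obtain d g where "d \<in> B" "d \<noteq> s"
          "pairing G g (insert s S) (insert d D)" by blast
        moreover have "B \<inter> D = {}" using S D matching by blast
        ultimately show ?thesis using S B by (intro bexI[of _ d]) (auto simp: A_def)
      next
        case False
        with s have m: "f s \<in> pverts G - B" "f (f s) = s" "f s \<noteq> s"
          using matching[of s] by auto
        \<comment> \<open>The partner is unplayed: in \<open>S\<close> it would put \<open>s\<close>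
          into \<open>D\<close>, and in \<open>D\<close> it would be \<open>f t\<close> with
          \<open>t\<close> in \<open>S\<close>, forcing \<open>t = s\<close>.\<close>
        have "f s \<notin> S" using m(2) s D by (metis DiffD2 imageI)
        moreover have "f s \<notin> D"
        proof
          assume "f s \<in> D"
          then obtain t where "t \<in> S" "f s = f t" using D by blast
          then have "s = t" using m(2) matching[of t] S by auto
          with s \<open>t \<in> S\<close> show False by blast
        qed
        moreover have "A (insert s S) (insert (f s) D)"
          using S D s False by (auto simp: A_def)
        ultimately show ?thesis using m by (intro bexI[of _ "f s"]) auto
      qed
      moreover from this have "insert s S \<union> D \<noteq> pverts G" by blast
      ultimately show ?thesis by (simp add: dominator_can_restore_def)
    qed
  next
    fix S D
    assume A: "A S D" and SD: "S \<inter> D = {}" "S \<union> D = pverts G"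
    show "dominating_set G D"
    proof (cases "\<exists>g. pairing G g S D")
      case True
      with SD pairing_final show ?thesis by blast
    next
      case False
      \<comment> \<open>Staller never entered \<open>B\<close>, so each of her vertices is adjacent
        to its partner in \<open>D\<close>.\<close>
      with A have "S \<subseteq> pverts G - B" "D = f ` S" by (auto simp: A_def)
      with SD matching show ?thesis unfolding dominating_set_def by blast
    qed
  qed
qed

section \<open>The grid and its 3 by 3 corner block\<close>

lemma pverts_grid [simp]: "pverts (path_graph m \<box> path_graph n) = {..<m} \<times> {..<n}"
  by (simp add: cartesian_product_def path_graph_def)

lemma parcs_grid [simp]:
  "((i, j), (k, l)) \<in> parcs (path_graph m \<box> path_graph n) \<longleftrightarrow>
    i < m \<and> k < m \<and> j < n \<and> l < n \<and>
    ((i = Suc k \<or> k = Suc i) \<and> j = l \<or> i = k \<and> (j = Suc l \<or> l = Suc j))"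
  by (auto simp: cartesian_product_def path_graph_def)

definition block :: "(nat \<times> nat) set" where
  "block = {0, 1, 2} \<times> {0, 1, 2}"

lemma mem_block: "(i, j) \<in> block \<longleftrightarrow> i < 3 \<and> j < 3"
proof -
  have "k < 3 \<longleftrightarrow> k \<in> {0, 1, 2}" for k :: nat
    by (simp, presburger)
  then show ?thesis unfolding block_def mem_Times_iff by simp
qed

lemma ball_block: "(\<forall>x \<in> block. P x) \<longleftrightarrow> P (0, 0) \<and> P (0, Suc 0) \<and> P (0, 2) \<and>
    P (Suc 0, 0) \<and> P (Suc 0, Suc 0) \<and> P (Suc 0, 2) \<and> P (2, 0) \<and> P (2, Suc 0) \<and> P (2, 2)"
  by (simp add: block_def)

lemma bex_block: "(\<exists>x \<in> block. P x) \<longleftrightarrow> P (0, 0) \<or> P (0, Suc 0) \<or> P (0, 2) \<or>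
    P (Suc 0, 0) \<or> P (Suc 0, Suc 0) \<or> P (Suc 0, 2) \<or> P (2, 0) \<or> P (2, Suc 0) \<or> P (2, 2)"
  by (simp add: block_def disj_assoc)

text \<open>Closed adjacency in the unbounded grid: being independent of \<open>m\<close> and
  \<open>n\<close>, it lets one check of the block serve all odd grids.\<close>

fun near :: "nat \<times> nat \<Rightarrow> nat \<times> nat \<Rightarrow> bool" where
  "near (i, j) (k, l) \<longleftrightarrow>
    i = k \<and> (j = l \<or> j = Suc l \<or> l = Suc j) \<or> (i = Suc k \<or> k = Suc i) \<and> j = l"

text \<open>
  After Staller's first move \<open>s\<close> in the \<open>3 \<times> 3\<close> block, Dominator answers \<open>d\<close> and then plays along \<open>h\<close>.
\<close>

definition answers :: "nat \<times> nat \<Rightarrow> nat \<times> nat \<Rightarrow> (nat \<times> nat \<Rightarrow> nat \<times> nat) \<Rightarrow> bool" where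
  "answers s d h \<longleftrightarrow> d \<in> block \<and> d \<noteq> s \<and> (\<forall>x \<in> block. h x \<in> block \<and> h (h x) = x) \<and>
    (\<forall>v \<in> block. near d v \<or>
      (\<exists>x \<in> block. near x v \<and> near (h x) v \<and> x \<noteq> s \<and> h x \<noteq> s \<and> h x \<noteq> x))"

definition answerable :: "nat \<times> nat \<Rightarrow> bool" where
  "answerable s \<longleftrightarrow> (\<exists>d h. answers s d h)"

text \<open>Conjugation: the answer becomes \<open>\<phi> d\<close> and the pairing
  \<open>\<phi> \<circ> h \<circ> \<phi>\<close>. The condition at \<open>v\<close> is the old one
  at \<open>\<phi> v\<close>, carried back by \<open>\<phi>\<close>, which is its own inverse on the
  block.\<close>

lemma answerable_symmetry:
  assumes "answerable s" and s: "s \<in> block"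
    and closed: "\<And>x. x \<in> block \<Longrightarrow> \<phi> x \<in> block"
    and invol: "\<And>x. x \<in> block \<Longrightarrow> \<phi> (\<phi> x) = x"
    and near: "\<And>x y. x \<in> block \<Longrightarrow> y \<in> block \<Longrightarrow> near x y \<Longrightarrow> near (\<phi> x) (\<phi> y)"
  shows "answerable (\<phi> s)"
proof -
  from assms(1) obtain d h where dh: "answers s d h"
    unfolding answerable_def by blast
  have d: "d \<in> block" "d \<noteq> s"
    and h: "\<And>x. x \<in> block \<Longrightarrow> h x \<in> block" "\<And>x. x \<in> block \<Longrightarrow> h (h x) = x"
    using dh by (simp_all add: answers_def)
  have inj: "\<phi> x = \<phi> y \<longleftrightarrow> x = y" if "x \<in> block" "y \<in> block" for x y
    using invol that by metis
  have "near (\<phi> d) v \<or> (\<exists>x \<in> block. near x v \<and> near (\<phi> (h (\<phi> x))) v \<and>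
      x \<noteq> \<phi> s \<and> \<phi> (h (\<phi> x)) \<noteq> \<phi> s \<and> \<phi> (h (\<phi> x)) \<noteq> x)" if v: "v \<in> block" for v
  proof -
    have "near d (\<phi> v) \<or>
        (\<exists>x \<in> block. near x (\<phi> v) \<and> near (h x) (\<phi> v) \<and> x \<noteq> s \<and> h x \<noteq> s \<and> h x \<noteq> x)"
      using dh closed[OF v] unfolding answers_def by blast
    then show ?thesis
    proof
      assume "near d (\<phi> v)"
      from near[OF d(1) closed[OF v] this] show ?thesis using invol[OF v] by simp
    next
      assume "\<exists>x \<in> block. near x (\<phi> v) \<and> near (h x) (\<phi> v) \<and> x \<noteq> s \<and> h x \<noteq> s \<and> h x \<noteq> x"
      then obtain x where x: "x \<in> block" "near x (\<phi> v)" "near (h x) (\<phi> v)" "x \<noteq> s" "h x \<noteq> s" "h x \<noteq> x"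
        by blast
      have "near (\<phi> x) v" "near (\<phi> (h x)) v"
        using near[OF x(1) closed[OF v] x(2)] near[OF h(1)[OF x(1)] closed[OF v] x(3)]
        unfolding invol[OF v] .
      moreover have "\<phi> x \<noteq> \<phi> s" "\<phi> (h x) \<noteq> \<phi> s" "\<phi> (h x) \<noteq> \<phi> x"
        using x inj[OF x(1) s] inj[OF h(1)[OF x(1)] s] inj[OF h(1)[OF x(1)] x(1)] by blast+
      ultimately show ?thesis
        using closed[OF x(1)] invol[OF x(1)] by (intro disjI2 bexI[of _ "\<phi> x"]) simp_all
    qed
  qed
  moreover have "\<phi> (h (\<phi> x)) \<in> block" "\<phi> (h (\<phi> (\<phi> (h (\<phi> x))))) = x" if x: "x \<in> block" for x
    using closed[OF x] closed[OF h(1)[OF closed[OF x]]] invol[OF h(1)[OF closed[OF x]]]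
      h(2)[OF closed[OF x]] invol[OF x] by simp_all
  moreover have "\<phi> d \<in> block" "\<phi> d \<noteq> \<phi> s"
    using closed[OF d(1)] inj[OF d(1) s] d(2) by blast+
  ultimately have "answers (\<phi> s) (\<phi> d) (\<lambda>x. \<phi> (h (\<phi> x)))"
    unfolding answers_def by (intro conjI ballI) assumption+
  then show ?thesis unfolding answerable_def by blast
qed

text \<open>
  By symmetry it suffices to treat one centre, one corner and one side as Staller's first move.
\<close>

lemma answerable_base:
  "answerable (1, 1)" "answerable (0, 2)" "answerable (1, 0)"
proof -
  \<comment> \<open>The answer \<open>(0, 1)\<close> hits the neighbourhoods centred at the top row
    \<open>(0, _)\<close> and at \<open>(1, 1)\<close>. Pair \<open>(0, 0)\<close>,
    \<open>(1, 0)\<close> serves the centre \<open>(1, 0)\<close>; pair \<open>(2, 0)\<close>,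
    \<open>(2, 1)\<close> serves both its ends, and so does \<open>(1, 2)\<close>,
    \<open>(2, 2)\<close>. Neither \<open>(1, 1)\<close> nor \<open>(0, 2)\<close> is in a
    pair.\<close>
  define h :: "nat \<times> nat \<Rightarrow> nat \<times> nat" where
    "h = transpose (1, 2) (2, 2) \<circ> transpose (2, 0) (2, 1) \<circ> transpose (0, 0) (1, 0)"
  have h: "h (0, 0) = (Suc 0, 0)" "h (0, Suc 0) = (0, Suc 0)" "h (0, 2) = (0, 2)"
    "h (Suc 0, 0) = (0, 0)" "h (Suc 0, Suc 0) = (Suc 0, Suc 0)" "h (Suc 0, 2) = (2, 2)"
    "h (2, 0) = (2, Suc 0)" "h (2, Suc 0) = (2, 0)" "h (2, 2) = (Suc 0, 2)"
    by (simp_all add: h_def transpose_def)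
  have "answers (1, 1) (0, 1) h" "answers (0, 2) (0, 1) h"
    unfolding answers_def ball_block bex_block h by (simp_all add: mem_block)
  then show "answerable (1, 1)" "answerable (0, 2)"
    unfolding answerable_def by blast+
  \<comment> \<open>With \<open>(1, 0)\<close> taken, its neighbourhood is served by the pair
    \<open>(0, 0)\<close>, \<open>(1, 1)\<close> instead.\<close>
  define k :: "nat \<times> nat \<Rightarrow> nat \<times> nat" where
    "k = transpose (1, 2) (2, 2) \<circ> transpose (2, 0) (2, 1) \<circ> transpose (0, 0) (1, 1)"
  have k: "k (0, 0) = (Suc 0, Suc 0)" "k (0, Suc 0) = (0, Suc 0)" "k (0, 2) = (0, 2)"
    "k (Suc 0, 0) = (Suc 0, 0)" "k (Suc 0, Suc 0) = (0, 0)" "k (Suc 0, 2) = (2, 2)"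
    "k (2, 0) = (2, Suc 0)" "k (2, Suc 0) = (2, 0)" "k (2, 2) = (Suc 0, 2)"
    by (simp_all add: k_def transpose_def)
  have "answers (1, 0) (0, 1) k"
    unfolding answers_def ball_block bex_block k by (simp add: mem_block)
  then show "answerable (1, 0)"
    unfolding answerable_def by blast
qed

lemma answerable_block:
  assumes "s \<in> block"
  shows "answerable s"
proof -
  let ?flip = "\<lambda>(i, j). (2 - i, j) :: nat \<times> nat"
  have flip: "answerable (2 - i, j)" if "answerable (i, j)" "(i, j) \<in> block" for i j
  proof -
    have "answerable (?flip (i, j))"
      using that
    proof (rule answerable_symmetry)
      show "?flip x \<in> block" "?flip (?flip x) = x" if "x \<in> block" for x
        using that by (cases x; auto simp: mem_block)+
      show "near (?flip x) (?flip y)" if "x \<in> block" "y \<in> block" "near x y" for x y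
      proof -
        obtain i j k l where xy: "x = (i, j)" "y = (k, l)" by fastforce
        \<comment> \<open>Coordinates are at most 2, so the subtraction does not truncate and the
          reflection exchanges the two directions of a step.\<close>
        with that have "i < 3" "k < 3" by (simp_all add: mem_block)
        then have "2 - i = Suc (2 - k) \<longleftrightarrow> k = Suc i" "2 - k = Suc (2 - i) \<longleftrightarrow> i = Suc k"
          by linarith+
        with xy that show ?thesis by auto
      qed
    qed
    then show ?thesis by simp
  qed
  have swap: "answerable (j, i)" if "answerable (i, j)" "(i, j) \<in> block" for i j
  proof -
    have "answerable (prod.swap (i, j))"
      using that by (rule answerable_symmetry) (auto simp: mem_block)
    then show ?thesis by simp
  qed
  \<comment> \<open>The reflection and the swap carry one corner to all corners and one side to all
    sides.\<close>
  have c20: "answerable (2, 0)" using swap[OF answerable_base(2)] by (simp add: block_def)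
  have c22: "answerable (2, 2)" using flip[OF answerable_base(2)] by (simp add: block_def)
  have c00: "answerable (0, 0)" using flip[OF c20] by (simp add: block_def)
  have e01: "answerable (0, 1)" using swap[OF answerable_base(3)] by (simp add: block_def)
  have e21: "answerable (2, 1)" using flip[OF e01] by (simp add: block_def)
  have e12: "answerable (1, 2)" using swap[OF e21] by (simp add: block_def)
  show ?thesis
    using assms answerable_base c20 c22 c00 e01 e21 e12 by (auto simp: block_def)
qed

section \<open>Odd and even grids\<close>

lemma grid_outcome_odd:
  assumes "odd m" "odd n" "3 \<le> m" "3 \<le> n"
  shows "has_outcome (path_graph m \<box> path_graph n) Outcome_D"
proof (rule outcome_D_matching_block)
  let ?G = "path_graph m \<box> path_graph n"
  \<comment> \<open>\<open>?p\<close> exchanges 3 with 4, 5 with 6 and so on, which exhausts the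
    indices from 3 on when the length is odd. Vertices with second coordinate at least 3 are matched
    in that coordinate, the remaining ones outside the block in the first.\<close>
  let ?p = "\<lambda>k. if odd k then Suc k else k - 1"
  let ?f = "\<lambda>(i, j). if 3 \<le> j then (i, ?p j) else (?p i, j)"
  have p: "3 \<le> ?p k" "?p (?p k) = k" "?p k = Suc k \<or> k = Suc (?p k)" if "3 \<le> k" for k
    using that by (presburger, auto)
  have p_less: "?p k < l" if "k < l" "odd l" for k l
    using that by (auto elim!: evenE oddE)
  show "?f x \<in> pverts ?G - block \<and> ?f (?f x) = x \<and> ?f x \<noteq> x \<and> (?f x, x) \<in> parcs ?G"
    if "x \<in> pverts ?G - block" for x
  proof -
    obtain i j where x: "x = (i, j)" by fastforce
    with that have ij: "i < m" "j < n" "3 \<le> i \<or> 3 \<le> j" by (auto simp: mem_block)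
    show ?thesis
    proof (cases "3 \<le> j")
      case True
      with ij x p[OF True] p_less[OF ij(2) assms(2)] show ?thesis
        by (auto simp: mem_block split del: if_split)
    next
      case False
      with ij have "3 \<le> i" by simp
      with ij x p[OF this] p_less[OF ij(1) assms(1)] False show ?thesis
        by (auto simp: mem_block split del: if_split)
    qed
  qed
  show sub: "block \<subseteq> pverts ?G" using assms by (auto simp: block_def)
  have near_iff: "u \<in> closed_nbhd ?G v \<longleftrightarrow> near u v" if "u \<in> block" "v \<in> block" for u v
    using that sub by (cases u; cases v) (auto simp: closed_nbhd_def)
  show "\<exists>d h. d \<in> block \<and> d \<noteq> s \<and> (\<forall>x \<in> block. h x \<in> block \<and> h (h x) = x) \<and>
      (\<forall>v \<in> block. d \<in> closed_nbhd ?G v \<or>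
        (\<exists>x \<in> block \<inter> closed_nbhd ?G v - {s}. h x \<in> closed_nbhd ?G v - {s} \<and> h x \<noteq> x))"
    if "s \<in> block" for s
  proof -
    from answerable_block[OF that] obtain d h where dh: "answers s d h"
      unfolding answerable_def by blast
    then have d: "d \<in> block" "d \<noteq> s" and h: "\<forall>x \<in> block. h x \<in> block \<and> h (h x) = x"
      unfolding answers_def by blast+
    have "d \<in> closed_nbhd ?G v \<or>
        (\<exists>x \<in> block \<inter> closed_nbhd ?G v - {s}. h x \<in> closed_nbhd ?G v - {s} \<and> h x \<noteq> x)"
      if "v \<in> block" for v
    proof -
      have "near d v \<or> (\<exists>x \<in> block. near x v \<and> near (h x) v \<and> x \<noteq> s \<and> h x \<noteq> s \<and> h x \<noteq> x)"
        using dh that unfolding answers_def by blast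
      with near_iff[OF _ that] d(1) h show ?thesis by blast
    qed
    with d h show ?thesis by blast
  qed
qed

lemma grid_outcome_even:
  assumes "even m \<or> even n"
  shows "has_outcome (path_graph m \<box> path_graph n) Outcome_D"
proof (rule outcome_D_matching_block)
  let ?G = "path_graph m \<box> path_graph n"
  \<comment> \<open>Here 0 goes with 1, 2 with 3 and so on along a side of even length; the matching
    is perfect and the block is empty.\<close>
  let ?p = "\<lambda>k. if even k then Suc k else k - 1"
  let ?f = "\<lambda>(i, j). if even n then (i, ?p j) else (?p i, j)"
  have p: "?p (?p k) = k" "?p k = Suc k \<or> k = Suc (?p k)" for k
    by auto
  have p_less: "?p k < l" if "k < l" "even l" for k l
    using that by (auto elim!: evenE oddE)
  show "?f x \<in> pverts ?G - {} \<and> ?f (?f x) = x \<and> ?f x \<noteq> x \<and> (?f x, x) \<in> parcs ?G"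
    if "x \<in> pverts ?G - {}" for x
  proof -
    obtain i j where x: "x = (i, j)" by fastforce
    with that have ij: "i < m" "j < n" by auto
    show ?thesis
    proof (cases "even n")
      case True
      with ij x p[of j] p_less[OF ij(2) True] show ?thesis
        by (auto split del: if_split)
    next
      case False
      with assms have "even m" by simp
      from ij x p[of i] p_less[OF ij(1) this] False show ?thesis
        by (auto split del: if_split)
    qed
  qed
qed auto

theorem theorem3p1:
  fixes m n :: nat
  assumes "2 \<le> m" and "m \<le> n"
  shows "has_outcome (path_graph m \<box> path_graph n) Outcome_D"
proof (cases "even m \<or> even n")
  case True
  then show ?thesis by (rule grid_outcome_even)
next
  case False
  moreover from this assms have "3 \<le> m" by (cases "m = 2") auto
  ultimately show ?thesis using assms by (intro grid_outcome_odd) auto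
qed

end
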